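(* For $N\in\mathbb N$, let $\mathrm{Dec}(N)$ be the set of subsets $A\subset[0,N]$ for which there exist $B,C\subset[0,N]$ with $A=B+C$ and $\min(|B|,|C|)\ge 2$. If $A$ is a subset of $[0,N]$ chosen uniformly at random (equivalently, each element of $[0,N]$ is included independently with probability $1/2$), then \[\mathbb P\big(A\in\mathrm{Dec}(N)\big)=\exp(-\Omega(N)),\] that is, there are constants $c>0$ and $K>0$ such that $|\mathrm{Dec}(N)|\le K\,2^{N+1}e^{-cN}$ for all $N\in\mathbb N$.
   Context: For real numbers $a\le b$, $[a,b]=\{x\in\mathbb Z\colon a\le x\le b\}$. For sets $B,C\subset\mathbb Z$, $B+C=\{b+c\colon b\in B,c\in C\}$. *)

theory Defs
  imports "HOL-Library.Set_Algebras" "HOL-Probability.Probability_Mass_Function"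
begin

text \<open>The sum \<open>B + C\<close> of sets is the elementwise sumset of \<open>Set_Algebras\<close>.\<close>

definition Dec :: "nat \<Rightarrow> int set set" where
  "Dec N = {A. A \<subseteq> {0..int N} \<and>
     (\<exists>B C. B \<subseteq> {0..int N} \<and> C \<subseteq> {0..int N} \<and> A = B + C \<and> min (card B) (card C) \<ge> 2)}"

definition random_subset :: "nat \<Rightarrow> int set pmf" where
  "random_subset N = pmf_of_set (Pow {0..int N})"

end

theory Submission
  imports Defs
begin

text \<open>
  Write \<open>A = B + C\<close> and \<open>n = N + 1\<close>, and let \<open>k\<close> and \<open>q\<close> be suitable constants.

  If \<open>C\<close> has at most \<open>k\<close> elements, there are polynomially many choices of \<open>C\<close>. For a fixed
  \<open>C\<close> every \<open>x \<in> A\<close> has a companion \<open>x + (c' - c) \<in> A\<close>, so \<open>A\<close> never meets \<open>x + (C - C)\<close> in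
  \<open>{x}\<close> alone; linearly many of these translates are disjoint and give independent constraints.

  If both summands have at least \<open>k\<close> elements and \<open>C\<close> has more than \<open>n / q\<close>, fix a
  \<open>k\<close>-subset \<open>F\<close> of \<open>B\<close>. Then \<open>A\<close> contains \<open>F + X\<close> for some \<open>X\<close> of linear size whose
  translates of \<open>F\<close> are disjoint, which leaves only \<open>2 ^ (n - k * card X)\<close> sets \<open>A\<close>; for large \<open>k\<close> this
  beats the number of choices of \<open>X\<close>.

  Otherwise \<open>B\<close> and \<open>C\<close> both have at most \<open>n / q\<close> elements, and there are too few such pairs.
\<close>

section \<open>Separated translates and independent local constraints\<close>

text \<open>Take \<open>X\<close> of maximal size among the separated subsets of \<open>U\<close>.
  No point can be added to it, so the translate at any \<open>u\<close> in \<open>U\<close> meets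
  the translate at some \<open>x\<close> in \<open>X\<close>. Hence \<open>U\<close> lies in
  \<open>X + S - S\<close>, which has at most \<open>card X * (card S)^2\<close> elements.\<close>

lemma exists_separated_translates:
  fixes S :: "'a::ab_group_add set"
  assumes "finite U" "finite S" "S \<noteq> {}"
  shows "\<exists>X\<subseteq>U. card U \<le> card X * (card S)\<^sup>2 \<and> disjoint_family_on (\<lambda>x. (+) x ` S) X"
proof -
  let ?P = "\<lambda>X. X \<subseteq> U \<and> disjoint_family_on (\<lambda>x. (+) x ` S) X"
  have "?P {}" by (simp add: disjoint_family_on_def)
  moreover have "\<forall>X. ?P X \<longrightarrow> card X < Suc (card U)"
    using assms(1) by (auto simp: less_Suc_eq_le card_mono)
  ultimately obtain X where X: "?P X" and mx: "\<And>Y. ?P Y \<Longrightarrow> card Y \<le> card X"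
    using ex_has_greatest_nat[of ?P "{}" card "Suc (card U)"] by (metis less_imp_le)
  have fX: "finite X" using X assms(1) finite_subset by blast
  have "U \<subseteq> (\<lambda>(x, s, t). x + s - t) ` (X \<times> S \<times> S)"
  proof
    fix u assume u: "u \<in> U"
    have "\<exists>x\<in>X. \<exists>s\<in>S. \<exists>t\<in>S. x + s = u + t"
    proof (cases "u \<in> X")
      case True
      then show ?thesis using assms(3) by blast
    next
      case False
      then have "\<not> ?P (insert u X)"
        using mx[of "insert u X"] fX by auto
      then have "\<not> disjoint_family_on (\<lambda>x. (+) x ` S) (insert u X)" using X u by auto
      then have "\<exists>x\<in>X. (+) u ` S \<inter> (+) x ` S \<noteq> {}"
        using X False by (subst (asm) disjoint_family_on_insert) auto
      then obtain x s t where "x \<in> X" "s \<in> S" "t \<in> S" "u + t = x + s" by auto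
      then show ?thesis by metis
    qed
    then obtain x s t where "x \<in> X" "s \<in> S" "t \<in> S" "u = x + s - t"
      by (metis add_diff_cancel_right')
    then show "u \<in> (\<lambda>(x, s, t). x + s - t) ` (X \<times> S \<times> S)"
      by (auto intro!: image_eqI[of _ _ "(x, s, t)"])
  qed
  then have "card U \<le> card (X \<times> S \<times> S)"
    using fX assms(2) by (intro surj_card_le) auto
  then show ?thesis
    using X by (intro exI[of _ X]) (simp add: card_cartesian_product power2_eq_square)
qed

text \<open>The traces of \<open>A\<close> on disjoint blocks can be chosen independently, and each
  constraint excludes one of the \<open>2 ^ card (S i)\<close> traces on its block. As a block has
  at most \<open>s\<close> elements, this removes a proportion of at least
  \<open>1 / 2 ^ s\<close>.\<close>

lemma card_avoiding_patterns_le: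
  assumes "finite I" "finite U" "disjoint_family_on S I"
    and "\<And>i. i \<in> I \<Longrightarrow> S i \<subseteq> U \<and> card (S i) \<le> s \<and> P i \<subseteq> S i"
  shows "real (card {A. A \<subseteq> U \<and> (\<forall>i\<in>I. A \<inter> S i \<noteq> P i)}) \<le> (1 - 1 / 2 ^ s) ^ card I * 2 ^ card U"
  using assms
proof (induction I arbitrary: U rule: finite_induct)
  case empty
  then have "{A. A \<subseteq> U \<and> (\<forall>i\<in>{}. A \<inter> S i \<noteq> P i)} = Pow U" by auto
  then show ?case using empty by (simp add: card_Pow)
next
  case (insert i I)
  let ?F = "\<lambda>U I. {A. A \<subseteq> U \<and> (\<forall>i\<in>I. A \<inter> S i \<noteq> P i)}"
  have Si: "S i \<subseteq> U" "card (S i) \<le> s" "P i \<subseteq> S i" using insert.prems(3) by auto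
  have fS: "finite (S i)" using Si insert.prems(1) finite_subset by blast
  have disj: "S j \<inter> S i = {}" if "j \<in> I" for j
    using insert.prems(2) insert.hyps that unfolding disjoint_family_on_def by fastforce
  have fin: "finite (?F (U - S i) I)"
    using insert.prems(1) by (auto intro: finite_subset[of _ "Pow U"])
  \<comment> \<open>Split \<open>A\<close> into its trace on \<open>S i\<close> and the rest. The
    other blocks are disjoint from \<open>S i\<close>, so the rest still satisfies their
    constraints.\<close>
  have "card (?F U (insert i I)) \<le> card ((Pow (S i) - {P i}) \<times> ?F (U - S i) I)"
  proof (rule card_inj_on_le)
    show "inj_on (\<lambda>A. (A \<inter> S i, A - S i)) (?F U (insert i I))"
      by (auto simp: inj_on_def)
    have "(A - S i) \<inter> S j = A \<inter> S j" if "j \<in> I" for A j using disj[OF that] by auto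
    then show "(\<lambda>A. (A \<inter> S i, A - S i)) ` ?F U (insert i I) \<subseteq> (Pow (S i) - {P i}) \<times> ?F (U - S i) I"
      by auto
  qed (use fin fS in auto)
  also have "\<dots> = (2 ^ card (S i) - 1) * card (?F (U - S i) I)"
    using fS Si by (simp add: card_cartesian_product card_Diff_singleton card_Pow)
  finally have "real (card (?F U (insert i I))) \<le> real ((2 ^ card (S i) - 1) * card (?F (U - S i) I))"
    by linarith
  also have "\<dots> = (2 ^ card (S i) - 1) * real (card (?F (U - S i) I))"
    by (simp add: of_nat_diff)
  also have "\<dots> \<le> (2 ^ card (S i) * (1 - 1 / 2 ^ s)) * ((1 - 1 / 2 ^ s) ^ card I * 2 ^ card (U - S i))"
  proof (rule mult_mono)
    have "(2::real) ^ card (S i) / 2 ^ s \<le> 1" using Si by simp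
    then show "(2::real) ^ card (S i) - 1 \<le> 2 ^ card (S i) * (1 - 1 / 2 ^ s)"
      by (simp add: right_diff_distrib)
    show "real (card (?F (U - S i) I)) \<le> (1 - 1 / 2 ^ s) ^ card I * 2 ^ card (U - S i)"
    proof (rule insert.IH)
      show "disjoint_family_on S I"
        using insert.prems(2) by (auto simp: disjoint_family_on_def)
      show "S j \<subseteq> U - S i \<and> card (S j) \<le> s \<and> P j \<subseteq> S j" if "j \<in> I" for j
        using insert.prems(3)[of j] disj[OF that] that by auto
    qed (use insert.prems in auto)
  qed auto
  also have "\<dots> = (1 - 1 / 2 ^ s) ^ card (insert i I) * (2 ^ card (S i) * 2 ^ card (U - S i))"
    using insert.hyps by simp
  also have "(2::real) ^ card (S i) * 2 ^ card (U - S i) = 2 ^ card U"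
    using Si fS insert.prems(1) card_mono[OF insert.prems(1) Si(1)]
    by (simp add: card_Diff_subset flip: power_add)
  finally show ?case .
qed

section \<open>Weighted counts of subsets\<close>

text \<open>Over all subsets the weight factorises over the elements of \<open>U\<close>. Both
  weighted counts below drop their conditions on \<open>X\<close> in order to reach this
  sum.\<close>

lemma sum_Pow_power_card:
  fixes t :: "'b::comm_semiring_1"
  assumes "finite U"
  shows "(\<Sum>X\<in>Pow U. t ^ card X) = (1 + t) ^ card U"
  using prod_add[OF assms, of "\<lambda>_. t" "\<lambda>_. 1"] by (simp add: add.commute)

lemma card_small_subsets_le:
  assumes "finite U"
  shows "card {C. C \<subseteq> U \<and> card C \<le> k} \<le> (card U + 1) ^ k"
proof -
  have "{C. C \<subseteq> U \<and> card C \<le> k} = (\<Union>j\<le>k. {C. C \<subseteq> U \<and> card C = j})" by auto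
  then have "card {C. C \<subseteq> U \<and> card C \<le> k} \<le> (\<Sum>j\<le>k. card {C. C \<subseteq> U \<and> card C = j})"
    by (simp add: card_UN_le)
  \<comment> \<open>The factor \<open>k choose j\<close>, at least 1 here, is inserted so that the
    sum becomes the binomial expansion of \<open>(card U + 1) ^ k\<close>.\<close>
  also have "\<dots> \<le> (\<Sum>j\<le>k. (k choose j) * card U ^ j)"
  proof (rule sum_mono)
    fix j assume "j \<in> {..k}"
    then have "1 \<le> k choose j" by (simp add: Suc_leI)
    moreover have "card U choose j \<le> card U ^ j"
      by (cases "j \<le> card U") (auto simp: binomial_le_pow binomial_eq_0)
    ultimately show "card {C. C \<subseteq> U \<and> card C = j} \<le> (k choose j) * card U ^ j"
      using n_subsets[OF assms, of j] by (metis mult_le_mono nat_mult_1)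
  qed
  also have "\<dots> = (card U + 1) ^ k" using binomial[of "card U" 1 k] by simp
  finally show ?thesis .
qed

text \<open>A Chernoff bound: each \<open>X\<close> is weighted by \<open>t ^ card X * t powr (- card U / q) \<ge> 1\<close>.\<close>

lemma card_sparse_subsets_le:
  fixes t :: real
  assumes "finite U" "q > 0" "0 < t" "t \<le> 1"
  shows "real (card {X. X \<subseteq> U \<and> q * card X \<le> card U}) \<le> ((1 + t) * t powr (- 1 / real q)) ^ card U"
proof -
  let ?n = "card U"
  have "real (card {X. X \<subseteq> U \<and> q * card X \<le> ?n}) = (\<Sum>X | X \<subseteq> U \<and> q * card X \<le> ?n. 1)"
    by simp
  also have "\<dots> \<le> (\<Sum>X | X \<subseteq> U \<and> q * card X \<le> ?n. t ^ card X * t powr (- ?n / q))"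
  proof (rule sum_mono)
    fix X assume "X \<in> {X. X \<subseteq> U \<and> q * card X \<le> ?n}"
    then have "real q * real (card X) \<le> real ?n" by (metis (mono_tags) mem_Collect_eq of_nat_le_iff of_nat_mult)
    then have "real (card X) + (- ?n / q) \<le> 0"
      using assms(2) by (simp add: field_simps)
    then have "t powr 0 \<le> t powr (card X + (- ?n / q))"
      using assms(3,4) by (intro powr_mono') auto
    then show "1 \<le> t ^ card X * t powr (- ?n / q)"
      using assms(3) by (simp only: powr_add powr_realpow) simp
  qed
  also have "\<dots> \<le> (\<Sum>X\<in>Pow U. t ^ card X * t powr (- ?n / q))"
    using assms by (intro sum_mono2) auto
  also have "\<dots> = (1 + t) ^ ?n * t powr (- ?n / q)"
    using sum_Pow_power_card[OF assms(1), of t] by (simp flip: sum_distrib_right)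
  also have "t powr (- ?n / q) = (t powr (- 1 / real q)) ^ ?n"
    using assms(3) by (simp add: powr_power)
  finally show ?thesis by (simp add: power_mult_distrib)
qed

text \<open>Here the weight is \<open>z ^ card X * z powr (- card U / (q * k\<^sup>2)) \<ge> 1\<close>, on separated \<open>X\<close>.\<close>

lemma card_supersets_of_translates_le:
  fixes U F :: "'a::ab_group_add set" and z :: real
  assumes "finite U" "finite F" "card F = k" "k > 0" "q > 0" "z \<ge> 1"
  shows "real (card {A. A \<subseteq> U \<and> (\<exists>X\<subseteq>U. card U < q * card X \<and> F + X \<subseteq> A)})
    \<le> (2 * (1 + z / 2 ^ k) * z powr (- 1 / real (q * k\<^sup>2))) ^ card U"
proof -
  let ?n = "card U" and ?L = "q * k\<^sup>2"
  \<comment> \<open>Thinning to separated translates costs a factor \<open>k^2\<close>, hence the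
    threshold \<open>q * k^2\<close> in place of \<open>q\<close>. Separation gives
    \<open>card (F + X) = k * card X\<close>, and containment in \<open>U\<close> makes this the
    number of elements on which \<open>A\<close> is forced.\<close>
  define \<X> where "\<X> = {X. X \<subseteq> U \<and> ?n \<le> ?L * card X \<and> disjoint_family_on (\<lambda>x. (+) x ` F) X \<and> F + X \<subseteq> U}"
  have f\<X>: "finite \<X>" unfolding \<X>_def using assms(1) by (auto intro: finite_subset[of _ "Pow U"])
  have cardFX: "card (F + X) = k * card X" if "X \<in> \<X>" for X
  proof -
    have "F + X = (\<Union>x\<in>X. (+) x ` F)" by (force simp: set_plus_def add.commute)
    moreover have "finite X" using that assms(1) finite_subset unfolding \<X>_def by blast
    ultimately show ?thesis
      using that assms(2,3) unfolding \<X>_def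
      by (simp add: card_UN_disjoint' card_image)
  qed
  have "{A. A \<subseteq> U \<and> (\<exists>X\<subseteq>U. ?n < q * card X \<and> F + X \<subseteq> A)} \<subseteq> (\<Union>X\<in>\<X>. {A. F + X \<subseteq> A \<and> A \<subseteq> U})"
  proof safe
    fix A X assume A: "A \<subseteq> U" "X \<subseteq> U" "?n < q * card X" "F + X \<subseteq> A"
    have "F \<noteq> {}" using assms by auto
    then obtain Y where Y: "Y \<subseteq> X" "card X \<le> card Y * k\<^sup>2" "disjoint_family_on (\<lambda>x. (+) x ` F) Y"
      using exists_separated_translates[of X F] A assms finite_subset by metis
    have "?n \<le> q * (card Y * k\<^sup>2)" using A(3) Y(2) by (meson le_trans less_imp_le mult_le_mono2)
    moreover have "F + Y \<subseteq> A" using A(4) Y(1) by (meson order_trans set_plus_mono2 subset_refl)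
    ultimately have "Y \<in> \<X>" using A Y unfolding \<X>_def by (auto simp: mult_ac)
    with \<open>F + Y \<subseteq> A\<close> A(1) show "A \<in> (\<Union>X\<in>\<X>. {A. F + X \<subseteq> A \<and> A \<subseteq> U})" by blast
  qed
  then have "card {A. A \<subseteq> U \<and> (\<exists>X\<subseteq>U. ?n < q * card X \<and> F + X \<subseteq> A)}
    \<le> card (\<Union>X\<in>\<X>. {A. F + X \<subseteq> A \<and> A \<subseteq> U})"
    using f\<X> assms(1) by (intro card_mono) (auto intro: finite_subset[of _ "Pow U"])
  also have "\<dots> \<le> (\<Sum>X\<in>\<X>. card {A. F + X \<subseteq> A \<and> A \<subseteq> U})"
    by (rule card_UN_le[OF f\<X>])
  finally have "real (card {A. A \<subseteq> U \<and> (\<exists>X\<subseteq>U. ?n < q * card X \<and> F + X \<subseteq> A)})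
    \<le> (\<Sum>X\<in>\<X>. real (card {A. F + X \<subseteq> A \<and> A \<subseteq> U}))"
    by (simp only: of_nat_le_iff flip: of_nat_sum)
  also have "\<dots> \<le> (\<Sum>X\<in>\<X>. 2 ^ ?n * z powr (- ?n / ?L) * (z / 2 ^ k) ^ card X)"
  proof (rule sum_mono)
    fix X assume X: "X \<in> \<X>"
    then have sub: "F + X \<subseteq> U" by (simp add: \<X>_def)
    have fFX: "finite (F + X)" using sub assms(1) finite_subset by blast
    have le: "k * card X \<le> ?n" using cardFX[OF X] card_mono[OF assms(1) sub] by simp
    \<comment> \<open>Only the part of \<open>A\<close> outside \<open>F + X\<close> is
      free.\<close>
    have "card {A. F + X \<subseteq> A \<and> A \<subseteq> U} \<le> card (Pow (U - (F + X)))"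
      by (rule card_inj_on_le[where f = "\<lambda>A. A - (F + X)"])
         (use assms(1) in \<open>auto simp: inj_on_def\<close>)
    also have "\<dots> = 2 ^ (?n - k * card X)"
      using assms(1) sub fFX by (simp add: card_Pow card_Diff_subset cardFX[OF X])
    finally have "real (card {A. F + X \<subseteq> A \<and> A \<subseteq> U}) \<le> real (2 ^ (?n - k * card X))"
      by linarith
    also have "\<dots> = 2 ^ ?n / (2 ^ k) ^ card X"
      using le by (simp only: of_nat_power of_nat_numeral) (simp add: power_diff power_mult)
    also have "\<dots> \<le> (2 ^ ?n / (2 ^ k) ^ card X) * (z powr (- ?n / ?L) * z ^ card X)"
    proof -
      have "real ?n \<le> real ?L * real (card X)"
        using X unfolding \<X>_def by (metis (mono_tags) mem_Collect_eq of_nat_le_iff of_nat_mult)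
      moreover have "real ?L > 0" using assms by simp
      ultimately have "0 \<le> - real ?n / real ?L + card X"
        by (simp only: field_simps)
      then have "z powr 0 \<le> z powr (- real ?n / real ?L + card X)"
        using assms(6) by (intro powr_mono) auto
      then have "1 \<le> z powr (- real ?n / real ?L) * z ^ card X"
        using assms(6) by (simp only: powr_add powr_realpow) simp
      then show ?thesis using mult_left_mono[of 1 _ "2 ^ ?n / (2 ^ k) ^ card X :: real"] by simp
    qed
    finally show "real (card {A. F + X \<subseteq> A \<and> A \<subseteq> U}) \<le> 2 ^ ?n * z powr (- ?n / ?L) * (z / 2 ^ k) ^ card X"
      by (simp add: power_divide mult_ac)
  qed
  also have "\<dots> \<le> (\<Sum>X\<in>Pow U. 2 ^ ?n * z powr (- ?n / ?L) * (z / 2 ^ k) ^ card X)"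
    using assms by (intro sum_mono2) (auto simp: \<X>_def)
  also have "\<dots> = 2 ^ ?n * z powr (- ?n / ?L) * (1 + z / 2 ^ k) ^ ?n"
    by (simp only: sum_Pow_power_card[OF assms(1)] flip: sum_distrib_left)
  also have "z powr (- ?n / ?L) = (z powr (- 1 / ?L)) ^ ?n"
    using assms(6) by (simp add: powr_power)
  finally show ?thesis by (simp only: power_mult_distrib mult_ac)
qed

section \<open>Sumsets with one small fixed summand\<close>

text \<open>The blocks are translates of \<open>D = C - C\<close> cut down to \<open>U\<close>. They
  have at most \<open>k^2\<close> elements, which gives the base, and separating them costs
  \<open>(card D)^2 <= k^4\<close>, which gives the exponent \<open>1 / k^4\<close>. All
  \<open>B\<close> are treated at once, so only the choices of \<open>C\<close> remain to be
  counted.\<close>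

lemma card_sumsets_with_fixed_summand_le:
  fixes U C :: "'a::ab_group_add set"
  assumes "finite U" "2 \<le> card C" "card C \<le> k"
  shows "real (card {A. A \<subseteq> U \<and> (\<exists>B. A = B + C)}) \<le> (2 * (1 - 1 / 2 ^ k\<^sup>2) powr (1 / real k ^ 4)) ^ card U"
proof -
  define D where "D = (\<lambda>(c, d). c - d) ` (C \<times> C)"
  have fC: "finite C" "C \<noteq> {}" using assms(2) by (auto intro: card_ge_0_finite)
  have fD: "finite D" "D \<noteq> {}" and cD: "card D \<le> k\<^sup>2"
  proof -
    have "card D \<le> card C * card C"
      unfolding D_def using card_image_le[of "C \<times> C"] fC by (simp add: card_cartesian_product)
    also have "\<dots> \<le> k\<^sup>2" using assms(3) by (simp add: power2_eq_square mult_le_mono)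
    finally show "card D \<le> k\<^sup>2" .
  qed (use fC in \<open>auto simp: D_def\<close>)
  \<comment> \<open>This puts \<open>x\<close> into its own block, so that \<open>{x}\<close> is a
    possible trace to forbid.\<close>
  have "0 \<in> D" using fC unfolding D_def by force
  obtain X where X: "X \<subseteq> U" "card U \<le> card X * (card D)\<^sup>2" "disjoint_family_on (\<lambda>x. (+) x ` D) X"
    using exists_separated_translates[OF assms(1) fD] by blast
  have fX: "finite X" using X assms(1) finite_subset by blast
  let ?S = "\<lambda>x. (+) x ` D \<inter> U"
  have "A \<inter> ?S x \<noteq> {x}" if "A \<subseteq> U" "A = B + C" "x \<in> X" for A B x
  proof
    assume eq: "A \<inter> ?S x = {x}"
    then have "x \<in> B + C" using that by blast
    then obtain b c where bc: "b \<in> B" "c \<in> C" "x = b + c" by (rule set_plus_elim)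
    \<comment> \<open>A second element of \<open>C\<close> moves \<open>x = b + c\<close> to another
      element of \<open>A\<close> inside the same block.\<close>
    obtain d where d: "d \<in> C" "d \<noteq> c"
      using assms(2) by (metis card_2_iff' card_le_Suc0_iff_eq fC(1) not_less_eq_eq numeral_2_eq_2)
    have "b + d \<in> A" using that bc d by auto
    moreover have "b + d = x + (d - c)" using bc by simp
    moreover have "d - c \<in> D" using bc d unfolding D_def by force
    ultimately have "b + d \<in> A \<inter> ?S x" using that(1) by blast
    then have "b + d = x" using eq by blast
    then show False using bc d by simp
  qed
  then have "{A. A \<subseteq> U \<and> (\<exists>B. A = B + C)} \<subseteq> {A. A \<subseteq> U \<and> (\<forall>x\<in>X. A \<inter> ?S x \<noteq> {x})}"
    by blast
  then have "card {A. A \<subseteq> U \<and> (\<exists>B. A = B + C)} \<le> card {A. A \<subseteq> U \<and> (\<forall>x\<in>X. A \<inter> ?S x \<noteq> {x})}"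
    using assms(1) by (intro card_mono) (auto intro: finite_subset[of _ "Pow U"])
  then have "real (card {A. A \<subseteq> U \<and> (\<exists>B. A = B + C)}) \<le> real (card {A. A \<subseteq> U \<and> (\<forall>x\<in>X. A \<inter> ?S x \<noteq> {x})})"
    by simp
  also have "\<dots> \<le> (1 - 1 / 2 ^ k\<^sup>2) ^ card X * 2 ^ card U"
  proof (rule card_avoiding_patterns_le[OF fX assms(1)])
    show "disjoint_family_on ?S X"
      using X(3) unfolding disjoint_family_on_def by blast
    fix x assume x: "x \<in> X"
    have "card (?S x) \<le> card ((+) x ` D)" using fD by (intro card_mono) auto
    also have "\<dots> \<le> k\<^sup>2" using cD fD card_image_le le_trans by blast
    finally show "?S x \<subseteq> U \<and> card (?S x) \<le> k\<^sup>2 \<and> {x} \<subseteq> ?S x"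
      using x X(1) \<open>0 \<in> D\<close> by (auto intro: image_eqI[of _ _ 0])
  qed
  also have "(1 - 1 / 2 ^ k\<^sup>2 :: real) ^ card X \<le> ((1 - 1 / 2 ^ k\<^sup>2) powr (1 / real k ^ 4)) ^ card U"
  proof -
    have k: "k > 0" using assms by auto
    have "(2::real) ^ k\<^sup>2 > 1" using k by (intro one_less_power) auto
    then have r: "0 < 1 - 1 / (2::real) ^ k\<^sup>2" "1 - 1 / (2::real) ^ k\<^sup>2 \<le> 1" by auto
    have "(card D)\<^sup>2 \<le> k ^ 4" using power_mono[OF cD, of 2] by (simp flip: power_mult)
    then have "card U \<le> card X * k ^ 4" using X(2) by (meson le_trans mult_le_mono2)
    then have "real (card U) \<le> real (card X) * real k ^ 4"
      by (metis of_nat_le_iff of_nat_mult of_nat_power)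
    then have "1 / real k ^ 4 * card U \<le> card X" using k by (simp add: field_simps)
    then have "(1 - 1 / 2 ^ k\<^sup>2) powr card X \<le> (1 - 1 / 2 ^ k\<^sup>2 :: real) powr (1 / k ^ 4 * card U)"
      using r by (intro powr_mono') auto
    then show ?thesis using r by (simp add: powr_realpow powr_power mult.commute)
  qed
  finally show ?thesis by (simp add: power_mult_distrib mult_ac)
qed

section \<open>Exponential decay\<close>

definition exp_small :: "(nat \<Rightarrow> real) \<Rightarrow> bool" where
  "exp_small f \<longleftrightarrow> (\<exists>c>0. \<exists>K>0. \<forall>n. f n \<le> K * exp (- c * real n))"

lemma exp_small_add:
  assumes "exp_small f" "exp_small g"
  shows "exp_small (\<lambda>n. f n + g n)"
proof -
  obtain c K where f: "c > 0" "K > 0" "\<And>n. f n \<le> K * exp (- c * n)"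
    using assms(1) unfolding exp_small_def by blast
  obtain d L where g: "d > 0" "L > 0" "\<And>n. g n \<le> L * exp (- d * n)"
    using assms(2) unfolding exp_small_def by blast
  have "f n + g n \<le> (K + L) * exp (- min c d * n)" for n
  proof -
    have "K * exp (- c * n) \<le> K * exp (- min c d * n)" "L * exp (- d * n) \<le> L * exp (- min c d * n)"
      using f g by (auto intro!: mult_right_mono)
    then show ?thesis using f(3)[of n] g(3)[of n] by (simp add: distrib_right)
  qed
  then show ?thesis unfolding exp_small_def
    using f(1,2) g(1,2) by (intro exI[of _ "min c d"] conjI exI[of _ "K + L"]) auto
qed

text \<open>With \<open>r = exp (- 2 * c)\<close>, half of the decay absorbs the polynomial through
  \<open>y ^ k / k! <= exp y\<close> at \<open>y = c * (n + 1)\<close>, and the other half remains.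
  The shift from \<open>n\<close> to \<open>n + 1\<close> accounts for \<open>exp c\<close> in the
  constant.\<close>

lemma exp_small_poly_times_power:
  assumes "0 < r" "r < 1"
  shows "exp_small (\<lambda>n. real (n + 1) ^ k * r ^ n)"
proof -
  define c where "c = - ln r / 2"
  have c: "c > 0" using assms by (simp add: c_def)
  have rc: "r ^ n = exp (- c * n) * exp (- c * n)" for n
    using assms by (simp add: c_def ln_realpow[symmetric] field_simps flip: exp_add)
  have "real (n + 1) ^ k * r ^ n \<le> (fact k / c ^ k * exp c) * exp (- c * n)" for n
  proof -
    have "(c * real (n + 1)) ^ k / fact k \<le> exp (c * real (n + 1))"
    proof -
      \<comment> \<open>A single term of the exponential series, all of whose terms are nonnegative
        here.\<close>
      have "(\<Sum>j\<in>{k}. (c * real (n + 1)) ^ j /\<^sub>R fact j) \<le> exp (c * real (n + 1))"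
        unfolding exp_def using c by (intro sum_le_suminf summable_exp_generic) auto
      then show ?thesis by (simp add: divide_inverse mult.commute)
    qed
    then have "real (n + 1) ^ k \<le> fact k / c ^ k * exp (c * real (n + 1))"
      using c unfolding power_mult_distrib by (simp add: pos_divide_le_eq pos_le_divide_eq mult_ac)
    also have "\<dots> = fact k / c ^ k * exp c * exp (c * n)"
      by (simp add: distrib_left exp_add)
    finally have "real (n + 1) ^ k * r ^ n \<le> fact k / c ^ k * exp c * exp (c * n) * r ^ n"
      using assms by (intro mult_right_mono) auto
    also have "\<dots> = fact k / c ^ k * exp c * exp (- c * n)"
      unfolding rc by (simp add: mult.assoc flip: exp_add)
    finally show ?thesis .
  qed
  then show ?thesis unfolding exp_small_def
    using c by (intro exI[of _ c] conjI exI[of _ "fact k / c ^ k * exp c"]) auto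
qed

section \<open>Combining the three cases\<close>

lemma card_UN_le_bound:
  assumes "finite I" "\<And>i. i \<in> I \<Longrightarrow> real (card (F i)) \<le> b"
  shows "real (card (\<Union>i\<in>I. F i)) \<le> real (card I) * b"
proof -
  have "real (card (\<Union>i\<in>I. F i)) \<le> (\<Sum>i\<in>I. real (card (F i)))"
    using card_UN_le[OF assms(1), of F] by (simp only: of_nat_le_iff flip: of_nat_sum)
  also have "\<dots> \<le> real (card I) * b" using assms(2) sum_bounded_above by metis
  finally show ?thesis .
qed

text \<open>\<open>T1\<close> collects the sumsets with a summand of at most \<open>k\<close>
  elements, \<open>T2\<close> those with a dense summand and another of at least \<open>k\<close>
  elements, \<open>T3\<close> those of two sparse summands, whence the square in the last term. The
  parameters stay free so that each base can be brought below 2 later.\<close>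

lemma card_decomposable_le:
  fixes U :: "'a::ab_group_add set" and t z :: real
  assumes U: "finite U" and k: "k > 0" and q: "q > 0" and t: "0 < t" "t \<le> 1" and z: "z \<ge> 1"
  shows "real (card {A. A \<subseteq> U \<and> (\<exists>B C. B \<subseteq> U \<and> C \<subseteq> U \<and> A = B + C \<and> min (card B) (card C) \<ge> 2)})
    \<le> real (card U + 1) ^ k * (2 * (1 - 1 / 2 ^ k\<^sup>2) powr (1 / real k ^ 4)) ^ card U
      + real (card U + 1) ^ k * (2 * (1 + z / 2 ^ k) * z powr (- 1 / real (q * k\<^sup>2))) ^ card U
      + (((1 + t) * t powr (- 1 / real q))\<^sup>2) ^ card U" (is "real (card ?D) \<le> ?b1 + ?b2 + ?b3")
proof -
  define \<C> where "\<C> = {C. C \<subseteq> U \<and> card C \<le> k}"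
  define \<S> where "\<S> = {X. X \<subseteq> U \<and> q * card X \<le> card U}"
  define T1 where "T1 = (\<Union>C\<in>{C\<in>\<C>. 2 \<le> card C}. {A. A \<subseteq> U \<and> (\<exists>B. A = B + C)})"
  define T2 where "T2 = (\<Union>F\<in>{F\<in>\<C>. card F = k}. {A. A \<subseteq> U \<and> (\<exists>X\<subseteq>U. card U < q * card X \<and> F + X \<subseteq> A)})"
  define T3 where "T3 = (\<lambda>(B, C). B + C) ` (\<S> \<times> \<S>)"
  have fin: "finite \<C>" "finite \<S>" using U by (auto simp: \<C>_def \<S>_def intro: finite_subset[of _ "Pow U"])
  have c\<C>: "real (card {C\<in>\<C>. P C}) \<le> real (card U + 1) ^ k" for P
  proof -
    have "card {C\<in>\<C>. P C} \<le> card \<C>" using fin by (intro card_mono) auto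
    also have "\<dots> \<le> (card U + 1) ^ k" unfolding \<C>_def by (rule card_small_subsets_le[OF U])
    finally show ?thesis by (metis of_nat_le_iff of_nat_power)
  qed
  have T1: "real (card T1) \<le> ?b1"
  proof -
    have "real (card T1) \<le> real (card {C\<in>\<C>. 2 \<le> card C}) * (2 * (1 - 1 / 2 ^ k\<^sup>2) powr (1 / real k ^ 4)) ^ card U"
      unfolding T1_def
      by (rule card_UN_le_bound, use fin in simp, rule card_sumsets_with_fixed_summand_le[OF U])
         (auto simp: \<C>_def)
    also have "\<dots> \<le> ?b1" using c\<C> by (intro mult_right_mono) auto
    finally show ?thesis .
  qed
  have T2: "real (card T2) \<le> ?b2"
  proof -
    have "real (card T2) \<le> real (card {F\<in>\<C>. card F = k}) * (2 * (1 + z / 2 ^ k) * z powr (- 1 / real (q * k\<^sup>2))) ^ card U"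
      unfolding T2_def
      by (rule card_UN_le_bound, use fin in simp, rule card_supersets_of_translates_le[OF U])
         (use k q z in \<open>auto simp: \<C>_def intro: card_ge_0_finite\<close>)
    also have "\<dots> \<le> ?b2" using c\<C> z by (intro mult_right_mono) auto
    finally show ?thesis .
  qed
  have T3: "real (card T3) \<le> ?b3"
  proof -
    have "card T3 \<le> card \<S> * card \<S>"
      unfolding T3_def using card_image_le[of "\<S> \<times> \<S>"] fin by (simp add: card_cartesian_product)
    then have "real (card T3) \<le> (real (card \<S>))\<^sup>2"
      by (metis of_nat_le_iff of_nat_mult power2_eq_square)
    also have "\<dots> \<le> (((1 + t) * t powr (- 1 / real q)) ^ card U)\<^sup>2"
      unfolding \<S>_def using card_sparse_subsets_le[OF U q t] by (intro power_mono) auto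
    also have "\<dots> = ?b3" by (simp flip: power_mult add: mult.commute)
    finally show ?thesis .
  qed
  \<comment> \<open>Only \<open>k\<close> elements of \<open>B\<close> are recorded, so that
    \<open>F\<close> ranges over polynomially many sets.\<close>
  have large: "B + C \<in> T2" if BC: "B \<subseteq> U" "C \<subseteq> U" "B + C \<subseteq> U" "k \<le> card B" "card U < q * card C" for B C
  proof -
    obtain F where F: "F \<subseteq> B" "card F = k" using BC(4) by (meson obtain_subset_with_card_n)
    then have "F + C \<subseteq> B + C" by (simp add: set_plus_mono2)
    then show ?thesis unfolding T2_def \<C>_def using F BC by blast
  qed
  have "?D \<subseteq> T1 \<union> T2 \<union> T3"
  proof safe
    fix B C assume BC: "B + C \<subseteq> U" "B \<subseteq> U" "C \<subseteq> U" "2 \<le> min (card B) (card C)"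
      and n3: "B + C \<notin> T3" and n2: "B + C \<notin> T2"
    have comm: "B + C = C + B" by (rule add.commute)
    \<comment> \<open>In the third case either summand can supply \<open>F\<close>, so
      \<open>large\<close> applies whichever of the two is dense.\<close>
    consider "card B \<le> k" | "card C \<le> k" | "k \<le> card B" "k \<le> card C" by linarith
    then show "B + C \<in> T1"
    proof cases
      case 1
      then show ?thesis using BC comm unfolding T1_def \<C>_def by auto
    next
      case 2
      then show ?thesis using BC unfolding T1_def \<C>_def by auto
    next
      case 3
      have "\<not> (B \<in> \<S> \<and> C \<in> \<S>)" using n3 unfolding T3_def by auto
      then have "card U < q * card B \<or> card U < q * card C" using BC unfolding \<S>_def by auto
      then have "B + C \<in> T2" using large[of B C] large[of C B] BC 3 comm by auto
      then show ?thesis using n2 by simp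
    qed
  qed
  moreover have "finite (T1 \<union> T2 \<union> T3)"
    using fin U by (auto simp: T1_def T2_def T3_def intro: finite_subset[of _ "Pow U"])
  ultimately have "card ?D \<le> card (T1 \<union> T2 \<union> T3)" by (intro card_mono)
  also have "\<dots> \<le> card T1 + card T2 + card T3" by (meson add_le_mono1 card_Un_le le_trans)
  finally show ?thesis using T1 T2 T3 by linarith
qed

theorem theorem6p2:
  shows "\<exists>c K :: real. c > 0 \<and> K > 0 \<and>
    (\<forall>N :: nat.
       measure_pmf.prob (random_subset N) (Dec N) \<le> K * exp (- c * real N) \<and>
       real (card (Dec N)) \<le> K * 2 ^ (N + 1) * exp (- c * real N))"
proof -
  \<comment> \<open>Each \<open>r\<close> is a base from \<open>card_decomposable_le\<close> divided
    by 2, with \<open>q = 16\<close>, \<open>t = 1 / 16\<close> and \<open>z = 2 ^ (k / 2)\<close>.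
    The choice of \<open>q\<close> and \<open>t\<close> gives
    \<open>r3 = (17 / 16)^2 * sqrt 2 / 2 < 1\<close>. The choice of \<open>z\<close> gives
    \<open>r2\<close> a gain of \<open>2 powr (- 1 / (2 * q * k))\<close> against a loss of only
    \<open>1 + 2 powr (- k / 2)\<close>, so that a large \<open>k\<close> such as 32
    suffices.\<close>
  define k :: nat where "k = 32"
  define r1 :: real where "r1 = (1 - 1 / 2 ^ k\<^sup>2) powr (1 / real k ^ 4)"
  define r2 :: real where "r2 = (1 + 2 ^ 16 / 2 ^ k) * (2 ^ 16) powr (- 1 / real (16 * k\<^sup>2))"
  define r3 :: real where "r3 = ((1 + 1 / 16) * (1 / 16) powr (- 1 / real 16))\<^sup>2 / 2"
  have r1: "0 < r1" "r1 < 1"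
  proof -
    have k: "k > 0" by (simp add: k_def)
    then have "(1::real) < 2 ^ k\<^sup>2" by (intro one_less_power) auto
    then have b: "0 < 1 - 1 / (2::real) ^ k\<^sup>2" "1 - 1 / (2::real) ^ k\<^sup>2 < 1" by auto
    show "0 < r1" unfolding r1_def using b by (simp only: powr_gt_zero)
    show "r1 < 1" unfolding r1_def using b k powr_less_mono2[of "1 / real k ^ 4" "1 - 1 / 2 ^ k\<^sup>2" 1] by auto
  qed
  have r2: "0 < r2" "r2 < 1"
  proof -
    have "(2 ^ 16 :: real) powr (- 1 / (16 * 32\<^sup>2)) = (2 powr 16) powr (- 1 / (16 * 32\<^sup>2))" by simp
    also have "\<dots> = 2 powr (- 1 / 1024)" by (simp only: powr_powr) simp
    also have "\<dots> = exp (- ln 2 / 1024)" by (simp add: powr_def)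
    also have "\<dots> \<le> exp (- 1 / 2048)" using ln2_ge_two_thirds by simp
    finally have a: "(2 ^ 16 :: real) powr (- 1 / (16 * 32\<^sup>2)) \<le> exp (- 1 / 2048)" .
    \<comment> \<open>On the exponential scale the loss is at most \<open>1 / 65536\<close>, against
      a gain of at least \<open>1 / 2048\<close>.\<close>
    have b: "1 + 2 ^ 16 / 2 ^ 32 \<le> exp (1 / 65536 :: real)"
      using exp_ge_add_one_self[of "1 / 65536 :: real"] by simp
    have "r2 \<le> exp (1 / 65536) * exp (- 1 / 2048)"
      unfolding r2_def k_def using a b by (intro mult_mono) auto
    also have "\<dots> < 1" by (simp flip: exp_add)
    finally show "r2 < 1" .
    show "0 < r2" unfolding r2_def k_def by simp
  qed
  have r3: "0 < r3" "r3 < 1"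
  proof -
    have "(1 / 16 :: real) powr (- 1 / 16) = (2 powr (- 4)) powr (- 1 / 16)"
      by (simp add: powr_minus_divide)
    also have "\<dots> = 2 powr (1 / 4)" by (simp only: powr_powr) simp
    finally have "((1 / 16 :: real) powr (- 1 / 16))\<^sup>2 = 2 powr (1 / 2)"
      by (simp add: power2_eq_square flip: powr_add)
    then have "r3 = (17 / 16)\<^sup>2 * sqrt 2 / 2"
      unfolding r3_def by (simp add: power_mult_distrib powr_half_sqrt power_divide)
    moreover have "sqrt 2 < (3 / 2 :: real)" by (rule real_less_lsqrt) (auto simp: power2_eq_square)
    ultimately show "r3 < 1" by (simp add: power2_eq_square)
    show "0 < r3" unfolding r3_def by simp
  qed
  have "exp_small (\<lambda>n. real (n + 1) ^ k * r1 ^ n + real (n + 1) ^ k * r2 ^ n + real (n + 1) ^ 0 * r3 ^ n)"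
    using r1 r2 r3 by (intro exp_small_add exp_small_poly_times_power)
  then obtain c K where cK: "c > 0" "K > 0"
    "\<And>n. real (n + 1) ^ k * r1 ^ n + real (n + 1) ^ k * r2 ^ n + real (n + 1) ^ 0 * r3 ^ n \<le> K * exp (- c * real n)"
    unfolding exp_small_def by blast
  have main: "real (card (Dec N)) \<le> K * exp (- c * real N) * 2 ^ (N + 1)" for N
  proof -
    define n where "n = N + 1"
    have cU: "card {0..int N} = n" by (simp add: n_def)
    have "real (card (Dec N)) \<le> real (n + 1) ^ k * (2 * r1) ^ n
        + real (n + 1) ^ k * (2 * r2) ^ n + (2 * r3) ^ n"
      using card_decomposable_le[of "{0..int N}" k 16 "1 / 16" "2 ^ 16"] k_def
      unfolding Dec_def r1_def r2_def r3_def cU by (simp only:) (simp add: mult.assoc)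
    also have "\<dots> = (real (n + 1) ^ k * r1 ^ n + real (n + 1) ^ k * r2 ^ n + real (n + 1) ^ 0 * r3 ^ n) * 2 ^ n"
      by (simp only: power_mult_distrib) (simp add: algebra_simps)
    also have "\<dots> \<le> K * exp (- c * real n) * 2 ^ n" using cK(3) by (intro mult_right_mono) auto
    \<comment> \<open>Replacing \<open>n = N + 1\<close> by \<open>N\<close> in the exponent only
      enlarges the bound, since \<open>c > 0\<close>.\<close>
    also have "\<dots> \<le> K * exp (- c * real N) * 2 ^ n"
      using cK(1,2) by (intro mult_right_mono mult_left_mono) (auto simp: n_def)
    finally show ?thesis by (simp add: n_def)
  qed
  have prob: "measure_pmf.prob (random_subset N) (Dec N) = real (card (Dec N)) / 2 ^ (N + 1)" for N
  proof -
    have "Pow {0..int N} \<inter> Dec N = Dec N" by (auto simp: Dec_def)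
    then show ?thesis unfolding random_subset_def
      by (subst measure_pmf_of_set) (auto simp: card_Pow nat_add_distrib)
  qed
  show ?thesis
  proof (intro exI conjI allI)
    fix N
    show "measure_pmf.prob (random_subset N) (Dec N) \<le> K * exp (- c * real N)"
      unfolding prob using main[of N] by (simp add: divide_le_eq)
    show "real (card (Dec N)) \<le> K * 2 ^ (N + 1) * exp (- c * real N)"
      using main[of N] by (simp add: mult_ac)
  qed (use cK in auto)
qed

end
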